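(* The following are equivalent: (1) VG: $\delta(V_n,V)\to 0$ as $n\to\infty$. (2) $\|K-K_n\|_{O\to X}\to 0$ as $n\to\infty$. (3) NC (norm convergence): $\|K-K_n\|_{O\to O}\to 0$ as $n\to\infty$.
   Context: Setting. $O$ is an infinite dimensional separable real Hilbert space with scalar product $\langle\cdot,\cdot\rangle$ and norm $|\cdot|$. $X\subseteq O$ is a dense subspace, itself a Hilbert space with continuous inclusion $X\to O$. $a$ is a continuous symmetric bilinear form on $X$ with $a(u,u)\ge 0$ for all $u\in X$, such that $\langle\cdot,\cdot\rangle+a$ is coercive on $X$; this form is taken as the scalar product of $X$, so $\|u\|^2=|u|^2+a(u,u)$ is the norm of $X$. Define $W=\{u\in X: a(u,u')=0\ \forall u'\in X\}$ and $V=\{u\in X:\langle u,w\rangle=0\ \forall w\in W\}$, so $X=V\oplus W$. $W$ may be infinite dimensional. It is assumed that the injection $V\to O$ is compact ($V$ carrying the norm of $X$). Discretization. $(X_n)_{n\in\mathbb N}$ is a sequence of finite dimensional subspaces of $X$ satisfying AS: for all $u\in X$, $\lim_{n\to\infty}\inf_{u'\in X_n}\|u-u'\|=0$. Define $W_n=\{u\in X_n: a(u,u')=0\ \forall u'\in X_n\}=X_n\cap W$ and $V_n=\{u\in X_n:\langle u,w\rangle=0\ \forall w\in W_n\}$, so $X_n=V_n\oplus W_n$ ($V_n$ need not be contained in $V$). Operators. $K:O\to X$ is defined by: $Ku\in V$ and $a(Ku,v)=\langle u,v\rangle$ for all $v\in V$. $K_n:O\to X$ is defined by: $K_nu\in V_n$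 and $a(K_nu,v)=\langle u,v\rangle$ for all $v\in V_n$. $\|\cdot\|_{A\to B}$ denotes the operator norm. Gap. For subspaces $U,U'$ of $X$, $\delta(U,U')=\sup_{u\in U, u\neq0}\inf_{u'\in U'}\|u-u'\|/\|u\|$ (supremum over the empty set being $0$). *)

theory Defs
  imports "HOL-Analysis.Analysis"
begin

text \<open>
  The Hilbert spaces O and X are types \<^typ>\<open>'o\<close> and \<^typ>\<open>'x\<close>; the inclusion of X into O
  is an injective bounded linear map \<open>\<iota>\<close>, so the scalar product of O restricted to X
  reads \<open>\<iota> u \<bullet> \<iota> v\<close>. Taking \<open>S = UNIV\<close> below gives W, V, K, and taking for S the
  n-th discrete space gives their discrete counterparts.
\<close>

definition form_kernel :: "('x \<Rightarrow> 'x \<Rightarrow> real) \<Rightarrow> 'x set \<Rightarrow> 'x set" where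
  "form_kernel a S = {u \<in> S. \<forall>u'\<in>S. a u u' = 0}"

definition form_complement ::
    "('x \<Rightarrow> 'o::real_inner) \<Rightarrow> ('x \<Rightarrow> 'x \<Rightarrow> real) \<Rightarrow> 'x set \<Rightarrow> 'x set" where
  "form_complement \<iota> a S = {u \<in> S. \<forall>w\<in>form_kernel a S. \<iota> u \<bullet> \<iota> w = 0}"

definition solution_operator ::
    "('x \<Rightarrow> 'o::real_inner) \<Rightarrow> ('x \<Rightarrow> 'x \<Rightarrow> real) \<Rightarrow> 'x set \<Rightarrow> 'o \<Rightarrow> 'x" where
  "solution_operator \<iota> a S u =
     (THE k. k \<in> form_complement \<iota> a S \<and> (\<forall>v\<in>form_complement \<iota> a S. a k v = u \<bullet> \<iota> v))"

definition compact_map_on ::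
    "'x::metric_space set \<Rightarrow> ('x \<Rightarrow> 'o::topological_space) \<Rightarrow> bool" where
  "compact_map_on V f \<longleftrightarrow> (\<forall>B. B \<subseteq> V \<and> bounded B \<longrightarrow> compact (closure (f ` B)))"

text \<open>The case distinction is needed because \<open>Sup {}\<close> is unspecified on the reals.\<close>

definition gap :: "'x::real_normed_vector set \<Rightarrow> 'x set \<Rightarrow> real" where
  "gap U U' = (if U - {0} = {} then 0 else (SUP u\<in>U - {0}. infdist u U' / norm u))"

end

(* Write |u| for the norm of O, <.,.> for its scalar product, \<parallel>u\<parallel> for the norm of X and P for
   the projection of X onto V along W. Everything rests on a(u, v) = a(u, Pv) and the two
   equations defining K and K_n.

   For v in V_n, testing with v gives \<parallel>v - Pv\<parallel>^2 = a(K_n v - K v, v): convergence O -> X implies VG.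

   If |K - K_n| is at most \<epsilon>, then for v = K_n u and w = v - Pv in W we have Kw = 0, so
   |w|^2 = <w, K_n u> = <u, K_n w> = <u, (K_n - K) w>, hence |w| is at most \<epsilon> |u|. Inserting this
   in a(e, e) = <u, e> + 2 <u, w> for e = Ku - K_n u controls \<parallel>e\<parallel>^2 by (\<epsilon>^2 + 3 \<epsilon>) |u|^2.

   Under VG the Poincare inequality of V transfers to V_n uniformly in n. The X-orthogonal
   projection of Ku on X_n lies in V_n, so \<parallel>Ku - K_n u\<parallel> is bounded by the distance of Ku to X_n
   plus the consistency error <u, Pe - e>, which is controlled by the gap. The distance tends
   to 0 uniformly for bounded u because a(Ku, Ku) = <u, Ku> makes K compact from O to X. *)
theory Submission imports Defs begin

section \<open>Variational problems on closed subspaces\<close>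

text \<open>The solution is the minimiser of the energy \<open>J v = b v v - 2 * f v\<close> on
  \<open>S\<close>; minimising sequences are Cauchy by the parallelogram identity. Coercivity is
  asked on \<open>S\<close> alone because the lemma is meant for \<open>a\<close>, which degenerates
  on W but is coercive on V.\<close>

lemma symmetric_lax_milgram:
  fixes b :: "'x::{real_inner, complete_space} \<Rightarrow> 'x \<Rightarrow> real"
  assumes b: "bounded_bilinear b"
    and sym: "\<And>u v. b u v = b v u"
    and S: "subspace S" "closed S"
    and c: "c > 0"
    and coercive: "\<And>v. v \<in> S \<Longrightarrow> c * (norm v)\<^sup>2 \<le> b v v"
    and f: "bounded_linear f"
  obtains k where "k \<in> S" "\<And>v. v \<in> S \<Longrightarrow> b k v = f v"
proof -
  interpret b: bounded_bilinear b by fact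
  interpret f: bounded_linear f by fact
  define J where "J v = b v v - 2 * f v" for v
  obtain F where F: "\<And>v. norm (f v) \<le> norm v * F"
    using f.bounded by blast
  have J_below: "- (F\<^sup>2 / c) \<le> J v" if "v \<in> S" for v
  proof -
    \<comment> \<open>Completing the square: \<open>c * t\<^sup>2 - 2 * t * F\<close> is at least
      \<open>- F\<^sup>2 / c\<close> for every real \<open>t\<close>, here
      \<open>t = norm v\<close>.\<close>
    have "0 \<le> (c * norm v - F)\<^sup>2" by simp
    hence "0 \<le> ((c * norm v)\<^sup>2 - 2 * (c * norm v) * F + F\<^sup>2) / c"
      using c by (simp add: power2_diff)
    also have "\<dots> = c * (norm v)\<^sup>2 - 2 * (norm v * F) + F\<^sup>2 / c"
      using c by (simp add: field_simps power2_eq_square)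
    finally show ?thesis
      using coercive[OF that] F[of v] unfolding J_def real_norm_def by linarith
  qed
  define m where "m = Inf (J ` S)"
  have bdd: "bdd_below (J ` S)"
    using J_below by (intro bdd_belowI2)
  have m_le: "m \<le> J v" if "v \<in> S" for v
    unfolding m_def using bdd that by (rule cINF_lower)
  have "\<exists>x\<in>S. J x < m + inverse (real (Suc n))" for n
  proof -
    have "J ` S \<noteq> {}" using S(1) subspace_0 by auto
    from cInf_lessD[OF this, of "m + inverse (real (Suc n))"] show ?thesis
      unfolding m_def by auto
  qed
  then obtain x where xS: "\<And>n. x n \<in> S" and Jx: "\<And>n. J (x n) < m + inverse (real (Suc n))"
    by metis
  have close: "c * (norm (x i - x j))\<^sup>2 \<le> 2 * (inverse (real (Suc i)) + inverse (real (Suc j)))" for i j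
  proof -
    have mid: "(1/2) *\<^sub>R (x i + x j) \<in> S"
      using xS S(1) by (simp add: subspace_add subspace_scale)
    \<comment> \<open>The linear part of \<open>J\<close> cancels at the midpoint, whose energy is
      at least \<open>m\<close>. Two nearly minimal points are therefore close in the norm of
      \<open>b\<close>.\<close>
    have "J (x i) + J (x j) = 2 * J ((1/2) *\<^sub>R (x i + x j)) + b (x i - x j) (x i - x j) / 2"
      unfolding J_def using sym[of "x i" "x j"]
      by (simp add: b.add_left b.add_right b.diff_left b.diff_right b.scaleR_left b.scaleR_right
          f.add f.scaleR field_simps)
    with m_le[OF mid] Jx[of i] Jx[of j]
    have "b (x i - x j) (x i - x j) \<le> 2 * (inverse (real (Suc i)) + inverse (real (Suc j)))"
      unfolding distrib_left by argo
    with coercive[of "x i - x j"] xS S(1) show ?thesis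
      by (meson order_trans subspace_diff)
  qed
  have "Cauchy x"
  proof (rule CauchyI)
    fix e :: real assume e: "e > 0"
    have "4 / (c * e\<^sup>2) > 0" using c e by simp
    obtain M where M: "real M > 4 / (c * e\<^sup>2)" using reals_Archimedean2 by blast
    have "norm (x i - x j) < e" if "i \<ge> M" "j \<ge> M" for i j
    proof -
      have small: "inverse (real (Suc k)) < c * e\<^sup>2 / 4" if "k \<ge> M" for k
      proof -
        have "4 / (c * e\<^sup>2) < real (Suc k)" using M that by linarith
        thus ?thesis using c e by (simp add: field_simps)
      qed
      have "c * (norm (x i - x j))\<^sup>2 < c * e\<^sup>2"
        using close[of i j] small[OF that(1)] small[OF that(2)] unfolding distrib_left by argo
      hence "(norm (x i - x j))\<^sup>2 < e\<^sup>2" using c by simp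
      thus ?thesis using e by (simp add: power2_less_imp_less)
    qed
    thus "\<exists>M. \<forall>i\<ge>M. \<forall>j\<ge>M. norm (x i - x j) < e" by blast
  qed
  then obtain k where k: "x \<longlonglongrightarrow> k" using Cauchy_convergent_iff convergent_def by blast
  have kS: "k \<in> S" using closed_sequentially[OF S(2)] xS k by blast
  have "(\<lambda>n. J (x n)) \<longlonglongrightarrow> J k"
    unfolding J_def by (intro tendsto_intros b.tendsto f.tendsto k)
  moreover have "(\<lambda>n. m + inverse (real (Suc n))) \<longlonglongrightarrow> m + 0"
    using LIMSEQ_inverse_real_of_nat by (intro tendsto_intros) (simp add: inverse_eq_divide)
  ultimately have Jk: "J k \<le> m"
    using Jx by (intro LIMSEQ_le[of _ "J k"]) (auto intro: less_imp_le)
  have "b k v = f v" if v: "v \<in> S" for v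
  proof (cases "v = 0")
    case True
    thus ?thesis by (simp add: b.zero_right f.zero)
  next
    case False
    define B D where "B = b v v" and "D = b k v - f v"
    have B: "B > 0"
      using coercive[OF v] False c unfolding B_def
      by (smt (verit) mult_pos_pos zero_less_norm_iff zero_less_power)
    \<comment> \<open>The minimiser of the quadratic
      \<open>t \<mapsto> J (k + t *\<^sub>R v)\<close>: going there lowers the energy by
      \<open>D\<^sup>2 / B\<close>, so minimality of \<open>k\<close> forces
      \<open>D = 0\<close>.\<close>
    define t where "t = - D / B"
    have "m \<le> J (k + t *\<^sub>R v)"
      using kS v S(1) by (intro m_le) (simp add: subspace_add subspace_scale)
    also have "J (k + t *\<^sub>R v) = J k + 2 * t * D + t\<^sup>2 * B"
      unfolding J_def B_def D_def using sym[of k v]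
      by (simp add: b.add_left b.add_right b.scaleR_left b.scaleR_right f.add f.scaleR
          algebra_simps power2_eq_square)
    also have "\<dots> = J k - D\<^sup>2 / B"
      unfolding t_def using B by (simp add: field_simps power2_eq_square)
    finally have "D\<^sup>2 / B \<le> 0" using Jk by linarith
    hence "D = 0" using B by (simp add: divide_le_0_iff)
    thus ?thesis by (simp add: D_def)
  qed
  with kS that show thesis by blast
qed

section \<open>Compactness in finite dimensional subspaces\<close>

text \<open>The ambient space may be infinite dimensional, so the compact set is built by hand: it
  is the image of a box of coefficients over an orthogonal generating set, and Cauchy-Schwarz bounds
  the coefficients of a bounded vector.\<close>

lemma finite_span_bounded_in_compact:
  fixes B :: "'x::real_inner set"
  assumes "finite B"
  obtains C where "compact C" "C \<subseteq> span B" "span B \<inter> cball 0 r \<subseteq> C"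
proof -
  obtain E where E: "finite E" "span E = span B" "pairwise orthogonal E"
    using basis_orthogonal[OF assms] by blast
  define P where "P F M = (\<lambda>t. \<Sum>e\<in>F. t e *\<^sub>R e) ` {t. \<forall>e. t e \<in> {-M..M::real}}"
    for F :: "'x set" and M
  \<comment> \<open>One more generator makes the box a continuous image of an interval times the
    smaller box, which gives compactness by induction.\<close>
  have P_insert: "P (insert e F) M = (\<lambda>(s, y). s *\<^sub>R e + y) ` ({-M..M} \<times> P F M)"
    if "finite F" "e \<notin> F" for e F M
  proof -
    have "s *\<^sub>R e + (\<Sum>e\<in>F. t e *\<^sub>R e) \<in> P (insert e F) M"
      if "s \<in> {-M..M}" "\<forall>e. t e \<in> {-M..M}" for s t
    proof -
      have "s *\<^sub>R e + (\<Sum>e\<in>F. t e *\<^sub>R e) = (\<Sum>d\<in>insert e F. (t(e := s)) d *\<^sub>R d)"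
        using \<open>finite F\<close> \<open>e \<notin> F\<close> by (auto intro!: sum.cong)
      thus ?thesis unfolding P_def using that by (intro image_eqI[of _ _ "t(e := s)"]) auto
    qed
    thus ?thesis
      using that unfolding P_def by (auto simp: image_iff)
  qed
  have P_compact: "compact (P F M)" if "finite F" for F M
    using that
  proof (induction F)
    case empty
    show ?case
      by (rule finite_imp_compact, rule finite_subset[of _ "{0}"]) (auto simp: P_def)
  next
    case (insert e F)
    show ?case unfolding P_insert[OF insert.hyps]
      by (intro compact_continuous_image compact_Times insert.IH)
        (auto simp: case_prod_unfold intro!: continuous_intros)
  qed
  \<comment> \<open>The coefficient along \<open>e\<close> is at most
    \<open>\<bar>r\<bar> / norm e\<close> in absolute value; summing these bounds over
    \<open>E\<close> dominates each of them and is nonnegative even for empty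
    \<open>E\<close>.\<close>
  obtain M where M: "\<And>e. e \<in> E \<Longrightarrow> norm (inverse (norm e)) * \<bar>r\<bar> \<le> M" "M \<ge> 0"
  proof
    let ?M = "\<Sum>e\<in>E. norm (inverse (norm e)) * \<bar>r\<bar>"
    show "norm (inverse (norm e)) * \<bar>r\<bar> \<le> ?M" if "e \<in> E" for e
      using E(1) that by (intro member_le_sum) auto
    show "?M \<ge> 0" by (intro sum_nonneg) auto
  qed
  show thesis
  proof
    show "compact (P E M)" using P_compact E(1) .
    show "P E M \<subseteq> span B"
      unfolding P_def E(2)[symmetric] by (auto intro!: span_sum span_scale intro: span_base)
    show "span B \<inter> cball 0 r \<subseteq> P E M"
    proof
      fix x assume x: "x \<in> span B \<inter> cball 0 r"
      \<comment> \<open>The value 0 outside \<open>E\<close> keeps \<open>t\<close> in the box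
        everywhere. If \<open>E\<close> contains the zero vector, division by zero gives it the
        harmless coefficient 0.\<close>
      define t where "t e = (if e \<in> E then (e \<bullet> x) / (e \<bullet> e) else 0)" for e
      define p where "p = (\<Sum>e\<in>E. t e *\<^sub>R e)"
      have p: "p = (\<Sum>e\<in>E. (e \<bullet> x / (e \<bullet> e)) *\<^sub>R e)"
        unfolding p_def t_def by (intro sum.cong) auto
      obtain u where u: "x = (\<Sum>e\<in>E. u e *\<^sub>R e)"
        using x unfolding E(2)[symmetric] span_finite[OF E(1)] by auto
      have "e \<bullet> x = u e * (e \<bullet> e)" if "e \<in> E" for e
      proof -
        have "e \<bullet> x = (\<Sum>d\<in>E. if d = e then u e * (e \<bullet> e) else 0)"
          unfolding u inner_sum_right using E(3) that
          by (intro sum.cong) (auto simp: pairwise_def orthogonal_def)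
        thus ?thesis using E(1) that by simp
      qed
      hence "x = p" unfolding p by (subst u, intro sum.cong) auto
      moreover have "t e \<in> {-M..M}" for e
      proof -
        have "\<bar>t e\<bar> \<le> M"
        proof (cases "e \<in> E \<and> e \<noteq> 0")
          case True
          have "\<bar>t e\<bar> = \<bar>e \<bullet> x\<bar> / (norm e)\<^sup>2" using True by (simp add: t_def power2_norm_eq_inner)
          also have "\<dots> \<le> (norm e * norm x) / (norm e)\<^sup>2"
            by (intro divide_right_mono Cauchy_Schwarz_ineq2) auto
          also have "\<dots> = norm (inverse (norm e)) * norm x"
            using True by (simp add: field_simps power2_eq_square)
          also have "\<dots> \<le> norm (inverse (norm e)) * \<bar>r\<bar>"
            using x by (intro mult_left_mono) auto
          also have "\<dots> \<le> M" using M True by blast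
          finally show ?thesis .
        qed (use M in \<open>auto simp: t_def\<close>)
        thus ?thesis by (simp add: abs_le_iff)
      qed
      ultimately show "x \<in> P E M" unfolding P_def p_def by blast
    qed
  qed
qed

lemma closed_span_finite:
  fixes B :: "'x::real_inner set"
  assumes "finite B"
  shows "closed (span B)"
  unfolding closed_sequential_limits
proof (intro allI impI, elim conjE)
  fix x l assume x: "\<forall>n. x n \<in> span B" "x \<longlonglongrightarrow> l"
  from x(2) have "bounded (range x)" by (rule convergent_imp_bounded)
  then obtain r where r: "\<And>n. norm (x n) \<le> r" by (auto simp: bounded_iff)
  obtain C where C: "compact C" "C \<subseteq> span B" "span B \<inter> cball 0 r \<subseteq> C"
    using finite_span_bounded_in_compact[OF assms] by metis
  have "x n \<in> C" for n using x(1) r C(3) by auto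
  hence "l \<in> C" using closed_sequentially[OF compact_imp_closed[OF C(1)]] x(2) by blast
  thus "l \<in> span B" using C(2) by blast
qed

text \<open>Shows that the complements V_n satisfy the same compactness requirement as V, so that
  one theory covers both.\<close>

lemma compact_map_on_finite_span:
  fixes B :: "'x::real_inner set" and f :: "'x \<Rightarrow> 'o::real_normed_vector"
  assumes "finite B" "V \<subseteq> span B" "bounded_linear f"
  shows "compact_map_on V f"
  unfolding compact_map_on_def
proof (intro allI impI, elim conjE)
  fix A assume A: "A \<subseteq> V" "bounded A"
  then obtain r where r: "\<And>x. x \<in> A \<Longrightarrow> norm x \<le> r" by (auto simp: bounded_iff)
  obtain C where C: "compact C" "C \<subseteq> span B" "span B \<inter> cball 0 r \<subseteq> C"
    using finite_span_bounded_in_compact[OF assms(1)] by metis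
  have "compact (f ` C)"
    using C(1) assms(3) by (intro compact_continuous_image linear_continuous_on)
  moreover have "f ` A \<subseteq> f ` C" using A C(3) r assms(2) by fastforce
  ultimately show "compact (closure (f ` A))"
    by (metis closure_minimal compact_imp_closed compact_Int_closed closed_closure
        inf.absorb_iff2)
qed

section \<open>The gap and distances to subspaces\<close>

text \<open>Since 0 lies in \<open>U'\<close>, every quotient in the supremum is at most 1. The
  supremum is thus over a bounded set and really dominates its members.\<close>

lemma gap_bounds:
  assumes "0 \<in> U'"
  shows infdist_le_gap: "u \<in> U \<Longrightarrow> infdist u U' \<le> gap U U' * norm u"
    and gap_nonneg: "0 \<le> gap U U'"
proof -
  have le: "infdist u U' / norm u \<le> 1" for u
    using infdist_le[OF assms, of u] by (simp add: divide_le_eq_1)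
  have bdd: "bdd_above ((\<lambda>u. infdist u U' / norm u) ` (U - {0}))"
    using le by (intro bdd_aboveI2)
  have upper: "infdist u U' / norm u \<le> gap U U'" if "u \<in> U - {0}" for u
  proof -
    have "U - {0} \<noteq> {}" using that by blast
    hence "gap U U' = (SUP u\<in>U - {0}. infdist u U' / norm u)" unfolding gap_def by simp
    thus ?thesis using cSUP_upper[OF that bdd] by simp
  qed
  show "infdist u U' \<le> gap U U' * norm u" if "u \<in> U"
  proof (cases "u = 0")
    case True
    thus ?thesis using assms by simp
  next
    case False
    thus ?thesis using upper[of u] that by (simp add: field_simps)
  qed
  show "0 \<le> gap U U'"
  proof (cases "U - {0} = {}")
    case False
    then obtain u where u: "u \<in> U - {0}" by blast
    have "0 \<le> infdist u U' / norm u" by (simp add: infdist_nonneg)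
    with upper[OF u] show ?thesis by linarith
  qed (simp add: gap_def)
qed

lemma gap_le:
  assumes "0 \<le> d" "\<And>u. u \<in> U \<Longrightarrow> infdist u U' \<le> d * norm u"
  shows "gap U U' \<le> d"
proof (cases "U - {0} = {}")
  case False
  have "infdist u U' / norm u \<le> d" if "u \<in> U - {0}" for u
    using assms(2)[of u] that by (simp add: field_simps)
  with False have "(SUP u\<in>U - {0}. infdist u U' / norm u) \<le> d" by (intro cSUP_least)
  thus ?thesis using False by (simp add: gap_def)
qed (use assms in \<open>simp add: gap_def\<close>)

lemma tendsto_zero_iff_eventually_le:
  fixes g :: "nat \<Rightarrow> real"
  assumes "\<And>n. 0 \<le> g n"
  shows "g \<longlonglongrightarrow> 0 \<longleftrightarrow> (\<forall>e>0. \<forall>\<^sub>F n in sequentially. g n \<le> e)"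
proof
  assume "g \<longlonglongrightarrow> 0"
  thus "\<forall>e>0. \<forall>\<^sub>F n in sequentially. g n \<le> e"
    by (blast dest: order_tendstoD(2) intro: less_imp_le eventually_mono)
next
  assume le: "\<forall>e>0. \<forall>\<^sub>F n in sequentially. g n \<le> e"
  show "g \<longlonglongrightarrow> 0"
  proof (rule tendstoI)
    fix e :: real assume "e > 0"
    hence "\<forall>\<^sub>F n in sequentially. g n \<le> e / 2" using le half_gt_zero by blast
    thus "\<forall>\<^sub>F n in sequentially. dist (g n) 0 < e"
      by (rule eventually_mono) (use assms \<open>e > 0\<close> in \<open>auto simp: dist_real_def abs_of_nonneg intro: le_less_trans\<close>)
  qed
qed

text \<open>By Pythagoras no point of \<open>S\<close> is nearer to \<open>x\<close> than
  \<open>p\<close>.\<close>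

lemma infdist_orthogonal:
  fixes S :: "'x::real_inner set"
  assumes "subspace S" "p \<in> S" "\<And>y. y \<in> S \<Longrightarrow> (x - p) \<bullet> y = 0"
  shows "infdist x S = norm (x - p)"
proof (rule antisym)
  show "infdist x S \<le> norm (x - p)"
    using infdist_le[OF assms(2), of x] by (simp add: dist_norm)
  have "norm (x - p) \<le> dist x y" if "y \<in> S" for y
  proof (rule power2_le_imp_le)
    have "p - y \<in> S" using assms that by (simp add: subspace_diff)
    hence "(x - p) \<bullet> (p - y) = 0" by (rule assms(3))
    hence "(norm ((x - p) + (p - y)))\<^sup>2 = (norm (x - p))\<^sup>2 + (norm (p - y))\<^sup>2"
      by (intro norm_add_Pythagorean) (simp add: orthogonal_def)
    thus "(norm (x - p))\<^sup>2 \<le> (dist x y)\<^sup>2" by (simp add: dist_norm)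
  qed simp
  thus "norm (x - p) \<le> infdist x S"
    using assms(2) unfolding infdist_def by (auto intro!: cINF_greatest)
qed

lemma infdist_scaleR_le:
  fixes S :: "'x::real_normed_vector set"
  assumes "subspace S" "c > 0"
  shows "infdist (c *\<^sub>R x) S \<le> c * infdist x S"
proof -
  have "S \<noteq> {}" using assms(1) subspace_0 by auto
  have "infdist (c *\<^sub>R x) S / c \<le> dist x y" if "y \<in> S" for y
  proof -
    have "c *\<^sub>R y \<in> S" using assms(1) that by (simp add: subspace_scale)
    hence "infdist (c *\<^sub>R x) S \<le> dist (c *\<^sub>R x) (c *\<^sub>R y)" by (rule infdist_le)
    also have "\<dots> = c * dist x y"
      using assms(2) by (simp add: dist_norm flip: scaleR_diff_right)
    finally show ?thesis using assms(2) by (simp add: field_simps)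
  qed
  with \<open>S \<noteq> {}\<close> have "infdist (c *\<^sub>R x) S / c \<le> infdist x S"
    unfolding infdist_def by (auto intro!: cINF_greatest)
  thus ?thesis using assms(2) by (simp add: field_simps)
qed

text \<open>The variational problem for the scalar product itself, with coercivity constant 1 and
  right-hand side \<open>\<lambda>y. x \<bullet> y\<close>.\<close>

lemma orthogonal_projection:
  fixes S :: "'x::{real_inner, complete_space} set"
  assumes "subspace S" "closed S"
  obtains p where "p \<in> S" "\<And>y. y \<in> S \<Longrightarrow> (x - p) \<bullet> y = 0"
proof -
  obtain p where p: "p \<in> S" "\<And>y. y \<in> S \<Longrightarrow> p \<bullet> y = x \<bullet> y"
    using symmetric_lax_milgram[OF bounded_bilinear_inner inner_commute assms, of 1 "\<lambda>y. x \<bullet> y"]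
      bounded_linear_inner_right
    by (metis dot_square_norm mult_1 order_refl zero_less_one)
  show thesis by (rule that[OF p(1)]) (simp add: inner_diff_left p(2))
qed

section \<open>The semidefinite form and its kernel\<close>

locale semidefinite_form =
  fixes \<iota> :: "'x::{real_inner, complete_space} \<Rightarrow> 'o::{real_inner, complete_space}"
    and a :: "'x \<Rightarrow> 'x \<Rightarrow> real"
  assumes incl: "bounded_linear \<iota>"
    and form: "bounded_bilinear a"
    and form_sym: "a u v = a v u"
    and form_nonneg: "0 \<le> a u u"
    and inner_eq: "u \<bullet> v = \<iota> u \<bullet> \<iota> v + a u v"
begin

sublocale incl: bounded_linear \<iota> by (rule incl)
sublocale form: bounded_bilinear a by (rule form)

lemma norm_sq: "(norm u)\<^sup>2 = (norm (\<iota> u))\<^sup>2 + a u u"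
  using inner_eq[of u u] by (simp add: power2_norm_eq_inner)

lemma norm_incl_le: "norm (\<iota> u) \<le> norm u"
  by (rule power2_le_imp_le) (use norm_sq[of u] form_nonneg[of u] in auto)

lemma form_diff_sq: "a (u - v) (u - v) = a u u - 2 * a u v + a v v"
  by (simp add: form.diff_left form.diff_right form_sym)

text \<open>Nonnegativity of \<open>a\<close> on \<open>u - t *\<^sub>R v\<close> for all
  \<open>t\<close>. As \<open>a\<close> may degenerate, the case \<open>a v v = 0\<close> needs its
  own argument.\<close>

lemma form_Cauchy_Schwarz: "(a u v)\<^sup>2 \<le> a u u * a v v"
proof -
  have q: "0 \<le> a u u - 2 * t * a u v + t\<^sup>2 * a v v" for t
    using form_nonneg[of "u - t *\<^sub>R v"] form_sym[of u v]
    by (simp add: form.diff_left form.diff_right form.scaleR_left form.scaleR_right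
        algebra_simps power2_eq_square)
  show ?thesis
  proof (cases "a v v = 0")
    case True
    have "a u v = 0"
    proof (rule ccontr)
      assume "a u v \<noteq> 0"
      \<comment> \<open>The quadratic is affine in \<open>t\<close> here, and this \<open>t\<close>
        gives it the value -1.\<close>
      thus False using q[of "(a u u + 1) / (2 * a u v)"] True by (simp add: field_simps)
    qed
    thus ?thesis using True by simp
  next
    case False
    hence pos: "a v v > 0" using form_nonneg[of v] by linarith
    have "0 \<le> a u u - (a u v)\<^sup>2 / a v v"
      using q[of "a u v / a v v"] pos by (simp add: field_simps power2_eq_square)
    thus ?thesis using pos by (simp add: field_simps)
  qed
qed

lemma form_le: "\<bar>a u v\<bar> \<le> norm u * norm v"
proof (rule power2_le_imp_le)
  have le: "a w w \<le> (norm w)\<^sup>2" for w using norm_sq[of w] by simp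
  have "(a u v)\<^sup>2 \<le> a u u * a v v" by (rule form_Cauchy_Schwarz)
  also have "\<dots> \<le> (norm u)\<^sup>2 * (norm v)\<^sup>2"
    by (intro mult_mono le form_nonneg) auto
  finally show "\<bar>a u v\<bar>\<^sup>2 \<le> (norm u * norm v)\<^sup>2" by (simp add: power_mult_distrib)
qed auto

lemma form_eq_0: "a u u = 0 \<Longrightarrow> a u v = 0"
  using form_Cauchy_Schwarz[of u v] by simp

text \<open>By Cauchy-Schwarz, zero energy makes \<open>a\<close> vanish against all of X and not
  only against \<open>S\<close>. In particular the discrete kernel W_n is the intersection of X_n
  and W.\<close>

lemma form_kernel_iff: "w \<in> form_kernel a S \<longleftrightarrow> w \<in> S \<and> a w w = 0"
  unfolding form_kernel_def using form_eq_0 by auto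

end

section \<open>Kernel, complement and solution operator of one space\<close>

text \<open>Formulated for a general \<open>S\<close> so that X itself and each X_n are
  instances.\<close>

locale form_space = semidefinite_form \<iota> a
  for \<iota> :: "'x::{real_inner, complete_space} \<Rightarrow> 'o::{real_inner, complete_space}" and a +
  fixes S :: "'x set"
  assumes subspace_S: "subspace S"
    and closed_S: "closed S"
    and compact_incl: "compact_map_on (form_complement \<iota> a S) \<iota>"
begin

abbreviation "W \<equiv> form_kernel a S"
abbreviation "V \<equiv> form_complement \<iota> a S"
abbreviation "K \<equiv> solution_operator \<iota> a S"

lemma subspace_W: "subspace W"
  using subspace_S unfolding subspace_def form_kernel_def
  by (auto simp: form.add_left form.scaleR_left form.zero_left)

lemma closed_W: "closed W"
proof -
  have "W = S \<inter> (\<lambda>w. a w w) -` {0}" by (auto simp: form_kernel_iff)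
  moreover have "continuous_on UNIV (\<lambda>w. a w w)"
    by (intro form.continuous_on continuous_on_id)
  ultimately show ?thesis
    using closed_S by (auto intro!: closed_Int closed_vimage)
qed

lemma subspace_V: "subspace V"
  using subspace_S unfolding subspace_def form_complement_def
  by (auto simp: incl.add incl.scaleR incl.zero inner_add_left)

lemma closed_V: "closed V"
  unfolding closed_sequential_limits
proof (intro allI impI, elim conjE)
  fix x l assume x: "\<forall>n. x n \<in> V" "x \<longlonglongrightarrow> l"
  have "l \<in> S" using closed_sequentially[OF closed_S, of x l] x by (auto simp: form_complement_def)
  moreover have "\<iota> l \<bullet> \<iota> w = 0" if "w \<in> W" for w
  proof -
    have "(\<lambda>n. \<iota> (x n) \<bullet> \<iota> w) \<longlonglongrightarrow> \<iota> l \<bullet> \<iota> w"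
      by (intro tendsto_intros incl.tendsto x(2))
    moreover have "\<iota> (x n) \<bullet> \<iota> w = 0" for n
      using x(1) that by (auto simp: form_complement_def)
    ultimately show ?thesis by (simp add: LIMSEQ_const_iff)
  qed
  ultimately show "l \<in> V" by (simp add: form_complement_def)
qed

text \<open>Compactness yields a limit in O only, which need not come from X. The Cauchy property is
  what can be lifted to the norm of X once the energies are controlled.\<close>

lemma compact_subsequence:
  fixes x :: "nat \<Rightarrow> 'x"
  assumes "\<And>n. x n \<in> V" "\<And>n. norm (x n) \<le> r"
  obtains s where "strict_mono s" "Cauchy (\<lambda>n. \<iota> (x (s n)))"
proof -
  have "bounded (range x)" using assms(2) by (auto simp: bounded_iff)
  hence c: "compact (closure (\<iota> ` range x))"
    using compact_incl assms(1) unfolding compact_map_on_def by blast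
  have mem: "\<iota> (x n) \<in> closure (\<iota> ` range x)" for n
    by (simp add: closure_subset[THEN subsetD])
  have "\<exists>l\<in>closure (\<iota> ` range x). \<exists>s. strict_mono s \<and> ((\<lambda>n. \<iota> (x n)) \<circ> s) \<longlonglongrightarrow> l"
    by (rule compact_imp_seq_compact[OF c, unfolded seq_compact_def, THEN spec, THEN mp])
      (use mem in blast)
  then obtain l s where s: "strict_mono s" and l: "((\<lambda>n. \<iota> (x n)) \<circ> s) \<longlonglongrightarrow> l" by blast
  from l have "Cauchy (\<lambda>n. \<iota> (x (s n)))"
    unfolding o_def by (rule LIMSEQ_imp_Cauchy)
  with s show thesis by (rule that)
qed

text \<open>Such a \<open>v\<close> lies in both V and W, hence is orthogonal to itself in
  O.\<close>

lemma form_positive: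
  assumes "v \<in> V" "a v v = 0"
  shows "v = 0"
proof -
  have "v \<in> W" using assms by (simp add: form_kernel_iff form_complement_def)
  hence "\<iota> v \<bullet> \<iota> v = 0" using assms(1) by (auto simp: form_complement_def)
  thus ?thesis using assms(2) inner_eq[of v v] by simp
qed

text \<open>Otherwise there are unit vectors in V with energies tending to 0. A subsequence is
  Cauchy in O, hence in X, and its limit is a unit vector of V with zero energy, which is
  impossible. The bound \<open>C \<ge> 1\<close> is a normalisation for later estimates.\<close>

lemma poincare:
  obtains C where "C \<ge> 1" "\<And>v. v \<in> V \<Longrightarrow> (norm v)\<^sup>2 \<le> C * a v v"
proof -
  have "\<exists>C. \<forall>v\<in>V. (norm v)\<^sup>2 \<le> C * a v v"
  proof (rule ccontr)
    assume "\<not> ?thesis"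
    hence "\<exists>v\<in>V. real (Suc n) * a v v < (norm v)\<^sup>2" for n by (auto simp: not_le)
    then obtain y where y: "\<And>n. y n \<in> V" "\<And>n. real (Suc n) * a (y n) (y n) < (norm (y n))\<^sup>2"
      by metis
    have pos: "norm (y n) > 0" for n
      using y(2)[of n] form.zero_left by auto
    define x where "x n = (1 / norm (y n)) *\<^sub>R y n" for n
    have xV: "x n \<in> V" for n unfolding x_def using y(1) subspace_V by (simp add: subspace_scale)
    have x1: "norm (x n) = 1" for n using pos[of n] by (simp add: x_def)
    have ax: "a (x n) (x n) \<le> inverse (real (Suc n))" for n
    proof -
      have "a (x n) (x n) = a (y n) (y n) / (norm (y n))\<^sup>2"
        by (simp add: x_def form.scaleR_left form.scaleR_right power2_eq_square)
      also have "\<dots> \<le> inverse (real (Suc n))"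
        using y(2)[of n] pos[of n] by (simp add: field_simps)
      finally show ?thesis .
    qed
    obtain s where s: "strict_mono s" "Cauchy (\<lambda>n. \<iota> (x (s n)))"
      using compact_subsequence[of x 1] xV x1 by auto
    have as: "(\<lambda>n. a (x (s n)) (x (s n))) \<longlonglongrightarrow> 0"
    proof (rule tendsto_sandwich[of "\<lambda>_. 0" _ _ "\<lambda>n. inverse (real (Suc n))"])
      show "\<forall>\<^sub>F n in sequentially. a (x (s n)) (x (s n)) \<le> inverse (real (Suc n))"
      proof (intro always_eventually allI)
        fix n
        have "inverse (real (Suc (s n))) \<le> inverse (real (Suc n))"
          using seq_suble[OF s(1), of n] by (simp add: le_imp_inverse_le)
        thus "a (x (s n)) (x (s n)) \<le> inverse (real (Suc n))" using ax[of "s n"] by linarith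
      qed
    qed (use form_nonneg LIMSEQ_inverse_real_of_nat in \<open>simp_all del: of_nat_Suc\<close>)
    have "Cauchy (\<lambda>n. x (s n))"
    proof (rule CauchyI)
      fix e :: real assume e: "e > 0"
      \<comment> \<open>The thresholds \<open>e / 2\<close> and \<open>e\<^sup>2 / 8\<close> add up
        to \<open>e\<^sup>2 / 4 + 4 * (e\<^sup>2 / 8)\<close>, which is below
        \<open>e\<^sup>2\<close>.\<close>
      obtain M where M: "\<And>i j. i \<ge> M \<Longrightarrow> j \<ge> M \<Longrightarrow> norm (\<iota> (x (s i)) - \<iota> (x (s j))) < e / 2"
        using CauchyD[OF s(2), of "e / 2"] e by auto
      have "\<forall>\<^sub>F n in sequentially. a (x (s n)) (x (s n)) < e\<^sup>2 / 8"
        by (rule order_tendstoD(2)[OF as]) (use e in simp)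
      then obtain N where N: "\<And>n. n \<ge> N \<Longrightarrow> a (x (s n)) (x (s n)) < e\<^sup>2 / 8"
        by (auto simp: eventually_sequentially)
      have "norm (x (s i) - x (s j)) < e" if "i \<ge> max M N" "j \<ge> max M N" for i j
      proof -
        let ?u = "x (s i)" and ?v = "x (s j)"
        have "(norm (\<iota> (?u - ?v)))\<^sup>2 < (e / 2)\<^sup>2"
          using M[of i j] that by (intro power_strict_mono) (auto simp: incl.diff)
        moreover have "a (?u - ?v) (?u - ?v) \<le> 2 * a ?u ?u + 2 * a ?v ?v"
          using form_nonneg[of "?u + ?v"] form_sym[of ?u ?v]
          by (simp add: form_diff_sq form.add_left form.add_right)
        moreover have "a ?u ?u < e\<^sup>2 / 8" "a ?v ?v < e\<^sup>2 / 8"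
          using N that by auto
        moreover have "(e / 2)\<^sup>2 = e\<^sup>2 / 4" "e\<^sup>2 > 0"
          using e by (auto simp: power_divide)
        ultimately have "(norm (?u - ?v))\<^sup>2 < e\<^sup>2"
          using norm_sq[of "?u - ?v"] by linarith
        thus ?thesis using e by (simp add: power2_less_imp_less)
      qed
      thus "\<exists>M. \<forall>i\<ge>M. \<forall>j\<ge>M. norm (x (s i) - x (s j)) < e" by blast
    qed
    then obtain l where l: "(\<lambda>n. x (s n)) \<longlonglongrightarrow> l"
      using Cauchy_convergent_iff convergent_def by blast
    have "l \<in> V" using closed_sequentially[OF closed_V, of "\<lambda>n. x (s n)" l] xV l by blast
    moreover have "a l l = 0"
      using LIMSEQ_unique[OF form.tendsto[OF l l] as] .
    ultimately have "l = 0" by (rule form_positive)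
    moreover have "norm l = 1"
      using LIMSEQ_unique[OF tendsto_norm[OF l], of 1] x1 by simp
    ultimately show False by simp
  qed
  then obtain C where C: "\<And>v. v \<in> V \<Longrightarrow> (norm v)\<^sup>2 \<le> C * a v v" by blast
  have "(norm v)\<^sup>2 \<le> max C 1 * a v v" if "v \<in> V" for v
    using C[OF that] mult_right_mono[OF max.cobounded1[of C 1] form_nonneg[of v]] by linarith
  thus thesis using that[of "max C 1"] by simp
qed

text \<open>Poincare makes \<open>a\<close> coercive on V with constant \<open>1 / C\<close>, which
  gives existence; definiteness on V gives uniqueness. This justifies the definite description in
  \<open>solution_operator\<close>.\<close>

lemma solution_ex1: "\<exists>!k. k \<in> V \<and> (\<forall>v\<in>V. a k v = u \<bullet> \<iota> v)"
proof -
  obtain C where C: "C \<ge> 1" "\<And>v. v \<in> V \<Longrightarrow> (norm v)\<^sup>2 \<le> C * a v v" using poincare by blast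
  have "bounded_linear (\<lambda>v. u \<bullet> \<iota> v)"
    by (rule bounded_linear_compose[OF bounded_linear_inner_right incl])
  moreover have "0 < 1 / C" "\<And>v. v \<in> V \<Longrightarrow> 1 / C * (norm v)\<^sup>2 \<le> a v v"
    using C by (auto simp: field_simps)
  ultimately obtain k where k: "k \<in> V" "\<And>v. v \<in> V \<Longrightarrow> a k v = u \<bullet> \<iota> v"
    using symmetric_lax_milgram[OF form form_sym subspace_V closed_V] by metis
  show ?thesis
  proof (intro ex1I conjI ballI)
    fix k' assume k': "k' \<in> V \<and> (\<forall>v\<in>V. a k' v = u \<bullet> \<iota> v)"
    have d: "k' - k \<in> V" using k k' subspace_V by (simp add: subspace_diff)
    have "a (k' - k) (k' - k) = 0" using k(2)[OF d] k' d by (subst form.diff_left) auto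
    thus "k' = k" using form_positive[OF d] by simp
  qed (use k in auto)
qed

lemma solution_in: "K u \<in> V"
  and solution_eq: "v \<in> V \<Longrightarrow> a (K u) v = u \<bullet> \<iota> v"
proof -
  have "K u \<in> V \<and> (\<forall>v\<in>V. a (K u) v = u \<bullet> \<iota> v)"
    unfolding solution_operator_def by (rule theI'[OF solution_ex1])
  thus "K u \<in> V" "v \<in> V \<Longrightarrow> a (K u) v = u \<bullet> \<iota> v" by blast+
qed

lemma solution_unique:
  assumes "k \<in> V" "\<And>v. v \<in> V \<Longrightarrow> a k v = u \<bullet> \<iota> v"
  shows "K u = k"
  unfolding solution_operator_def
  by (rule the1_equality[OF solution_ex1]) (use assms in blast)

text \<open>Test the equation with \<open>K u\<close> and cancel one factor
  \<open>norm (K u)\<close>.\<close>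

lemma norm_solution_le:
  assumes C: "\<And>v. v \<in> V \<Longrightarrow> (norm v)\<^sup>2 \<le> C * a v v" and "C \<ge> 0"
  shows "norm (K u) \<le> C * norm u"
proof -
  have "(norm (K u))\<^sup>2 \<le> C * a (K u) (K u)" by (intro C solution_in)
  also have "\<dots> \<le> C * (norm u * norm (K u))"
    using solution_eq[OF solution_in, of u u] norm_cauchy_schwarz[of u "\<iota> (K u)"]
      mult_left_mono[OF norm_incl_le[of "K u"] norm_ge_zero[of u]] \<open>C \<ge> 0\<close>
    by (intro mult_left_mono) auto
  finally have "norm (K u) * norm (K u) \<le> (C * norm u) * norm (K u)"
    by (simp add: power2_eq_square mult.assoc)
  thus ?thesis using \<open>C \<ge> 0\<close> by (cases "norm (K u) = 0") auto
qed

lemma bounded_linear_solution: "bounded_linear K"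
proof -
  obtain C where C: "C \<ge> 1" "\<And>v. v \<in> V \<Longrightarrow> (norm v)\<^sup>2 \<le> C * a v v" using poincare by blast
  show ?thesis
  proof (rule bounded_linear_intro)
    show "K (x + y) = K x + K y" for x y
      by (rule solution_unique) (use subspace_V solution_in in
        \<open>auto simp: subspace_add form.add_left solution_eq inner_add_left\<close>)
    show "K (r *\<^sub>R x) = r *\<^sub>R K x" for r x
      by (rule solution_unique) (use subspace_V solution_in in
        \<open>auto simp: subspace_scale form.scaleR_left solution_eq\<close>)
    show "norm (K x) \<le> norm x * C" for x
      using norm_solution_le[of C x] C by (simp add: mult.commute)
  qed
qed

text \<open>Since \<open>a\<close> vanishes against W, orthogonality to W means the same in X and in
  O. The remainder of the X-orthogonal projection on W therefore lies in V.\<close>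

lemma decomposition:
  assumes "x \<in> S"
  obtains p where "p \<in> V" "x - p \<in> W"
proof -
  obtain w where w: "w \<in> W" "\<And>y. y \<in> W \<Longrightarrow> (x - w) \<bullet> y = 0"
    using orthogonal_projection[OF subspace_W closed_W, of x] by metis
  have "\<iota> (x - w) \<bullet> \<iota> y = 0" if "y \<in> W" for y
    using w(2)[OF that] inner_eq[of "x - w" y] form_eq_0[of y "x - w"] form_sym[of "x - w" y] that
    by (simp add: form_kernel_iff)
  moreover have "x - w \<in> S"
    using assms w(1) subspace_S by (simp add: form_kernel_iff subspace_diff)
  ultimately have "x - w \<in> V" by (simp add: form_complement_def)
  thus thesis using that[of "x - w"] w(1) by simp
qed

text \<open>Pointwise approximation is uniform on relatively compact sets, and \<open>K\<close> maps
  the unit ball of O to such a set in X. A violating sequence is normalised, and approximation at a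
  limit \<open>z\<close> of its images gives the contradiction.\<close>

lemma uniform_approximation:
  fixes Y :: "nat \<Rightarrow> 'x set"
  assumes Y: "\<And>n. subspace (Y n)"
    and approx: "\<And>u. (\<lambda>n. infdist u (Y n)) \<longlonglongrightarrow> 0"
    and e: "e > 0"
  shows "\<forall>\<^sub>F n in sequentially. \<forall>u. infdist (K u) (Y n) \<le> e * norm u"
proof (rule ccontr)
  interpret K: bounded_linear K by (rule bounded_linear_solution)
  assume "\<not> ?thesis"
  hence "\<forall>N. \<exists>n\<ge>N. \<exists>u. e * norm u < infdist (K u) (Y n)"
    by (simp add: eventually_sequentially not_le)
  then obtain m u where m: "\<And>N. m N \<ge> N" and u: "\<And>N. e * norm (u N) < infdist (K (u N)) (Y (m N))"
    by metis
  have pos: "norm (u N) > 0" for N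
    using u[of N] subspace_0[OF Y, of "m N"] K.zero by auto
  define y where "y N = (1 / norm (u N)) *\<^sub>R u N" for N
  have y1: "norm (y N) = 1" for N using pos[of N] by (simp add: y_def)
  have far: "e < infdist (K (y N)) (Y (m N))" for N
  proof -
    have "K (u N) = norm (u N) *\<^sub>R K (y N)"
      using pos[of N] by (simp add: y_def K.scaleR)
    hence "e * norm (u N) < norm (u N) * infdist (K (y N)) (Y (m N))"
      using u[of N] infdist_scaleR_le[OF Y[of "m N"] pos[of N], of "K (y N)"] by simp
    thus ?thesis using pos[of N] by (simp add: mult.commute)
  qed
  obtain C where "\<And>x. norm (K x) \<le> norm x * C" using K.bounded by blast
  hence "norm (K (y N)) \<le> C" for N using y1[of N] by (metis mult_1)
  then obtain s where s: "strict_mono s" "Cauchy (\<lambda>n. \<iota> (K (y (s n))))"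
    using compact_subsequence[of "\<lambda>N. K (y N)" C] solution_in by blast
  have "Cauchy (\<lambda>n. K (y (s n)))"
  proof (rule CauchyI)
    fix r :: real assume r: "r > 0"
    \<comment> \<open>With \<open>\<iota> (K h)\<close> shorter than \<open>d\<close>, the energy of
      \<open>K h\<close> is below \<open>2 * d\<close> and the O-part of its squared norm is at most
      \<open>d\<^sup>2 \<le> d\<close>; the sum stays below \<open>r\<^sup>2\<close>.\<close>
    define d where "d = min 1 (r\<^sup>2 / 3)"
    have d: "0 < d" "d \<le> 1" "3 * d \<le> r\<^sup>2" using r by (auto simp: d_def)
    obtain M where M: "\<And>i j. i \<ge> M \<Longrightarrow> j \<ge> M \<Longrightarrow>
        norm (\<iota> (K (y (s i))) - \<iota> (K (y (s j)))) < d"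
      using CauchyD[OF s(2) d(1)] by auto
    have "norm (K (y (s i)) - K (y (s j))) < r" if "i \<ge> M" "j \<ge> M" for i j
    proof -
      define h where "h = y (s i) - y (s j)"
      have Kh: "K h = K (y (s i)) - K (y (s j))" by (simp add: h_def K.diff)
      have small: "norm (\<iota> (K h)) < d" using M[OF that] by (simp add: Kh incl.diff)
      have "norm h \<le> 2"
        using norm_triangle_ineq4[of "y (s i)" "y (s j)"] y1 by (simp add: h_def)
      have "a (K h) (K h) \<le> norm h * norm (\<iota> (K h))"
        using solution_eq[OF solution_in] norm_cauchy_schwarz by metis
      also have "\<dots> \<le> 2 * norm (\<iota> (K h))"
        using \<open>norm h \<le> 2\<close> by (intro mult_right_mono) auto
      finally have "a (K h) (K h) < 2 * d" using small by linarith
      moreover have "(norm (\<iota> (K h)))\<^sup>2 \<le> d"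
        using power_mono[OF less_imp_le[OF small] norm_ge_zero, of 2]
          mult_left_mono[OF d(2) less_imp_le[OF d(1)]] unfolding power2_eq_square by linarith
      ultimately have "(norm (K h))\<^sup>2 < r\<^sup>2" using norm_sq[of "K h"] d(3) by linarith
      thus ?thesis using r unfolding Kh by (simp add: power2_less_imp_less)
    qed
    thus "\<exists>M. \<forall>i\<ge>M. \<forall>j\<ge>M. norm (K (y (s i)) - K (y (s j))) < r" by blast
  qed
  then obtain z where z: "(\<lambda>n. K (y (s n))) \<longlonglongrightarrow> z"
    using Cauchy_convergent_iff convergent_def by blast
  \<comment> \<open>The indices \<open>m (s n)\<close> need not increase, but they are at least
    \<open>n\<close>, so the approximation property applies along them.\<close>
  have "filterlim (\<lambda>n. m (s n)) sequentially sequentially"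
    by (rule filterlim_at_top_mono[OF filterlim_ident])
      (use m seq_suble[OF s(1)] in \<open>auto intro!: always_eventually intro: order_trans\<close>)
  hence "(\<lambda>n. infdist z (Y (m (s n)))) \<longlonglongrightarrow> 0"
    using filterlim_compose[OF approx] by blast
  moreover have "(\<lambda>n. dist (K (y (s n))) z) \<longlonglongrightarrow> 0"
    by (rule tendsto_dist_iff[THEN iffD1, OF z])
  ultimately have "(\<lambda>n. infdist z (Y (m (s n))) + dist (K (y (s n))) z) \<longlonglongrightarrow> 0 + 0"
    by (rule tendsto_add)
  hence "e \<le> 0 + 0"
  proof (rule LIMSEQ_le_const, intro exI allI impI)
    show "e \<le> infdist z (Y (m (s n))) + dist (K (y (s n))) z" for n
      using far[of "s n"] infdist_triangle[of "K (y (s n))" "Y (m (s n))" z] by linarith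
  qed
  thus False using e by simp
qed

end

section \<open>Comparison of the exact and the discrete problem\<close>

locale galerkin =
  semidefinite_form \<iota> a + exact: form_space \<iota> a UNIV + discrete: form_space \<iota> a S
  for \<iota> :: "'x::{real_inner, complete_space} \<Rightarrow> 'o::{real_inner, complete_space}" and a S
begin

text \<open>The bridge between the two problems: a vector of V_n outside V is no test vector for
  \<open>K\<close>, but its V-part is, and \<open>a\<close> does not see the difference.\<close>

lemma form_kernel_part:
  assumes "v - p \<in> exact.W"
  shows "a u v = a u p"
proof -
  have "a u (v - p) = 0"
    using assms form_eq_0[of "v - p" u] form_sym[of u "v - p"] by (simp add: form_kernel_iff)
  thus ?thesis by (simp add: form.diff_right)
qed

lemma incl_orthogonal: "p \<in> exact.V \<Longrightarrow> w \<in> exact.W \<Longrightarrow> \<iota> w \<bullet> \<iota> p = 0"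
  unfolding form_complement_def by (auto simp: inner_commute)

text \<open>V and W are orthogonal in X too, so the W-part measures the distance to V.\<close>

lemma infdist_exact:
  assumes "p \<in> exact.V" "v - p \<in> exact.W"
  shows "infdist v exact.V = norm (v - p)"
proof (rule infdist_orthogonal[OF exact.subspace_V assms(1)])
  fix y assume "y \<in> exact.V"
  hence "\<iota> (v - p) \<bullet> \<iota> y = 0" using assms(2) by (rule incl_orthogonal)
  moreover have "a (v - p) y = 0" using assms(2) form_eq_0 by (simp add: form_kernel_iff)
  ultimately show "(v - p) \<bullet> y = 0" by (simp add: inner_eq)
qed

text \<open>On W the norms of X and O agree, and \<open>\<iota> v \<bullet> \<iota> v\<close> and
  \<open>\<iota> v \<bullet> \<iota> p\<close> are values of the discrete and the exact equation for
  the same right-hand side \<open>\<iota> v\<close>.\<close>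

lemma defect_sq:
  assumes v: "v \<in> discrete.V" and p: "p \<in> exact.V" "v - p \<in> exact.W"
  shows "(norm (v - p))\<^sup>2 = a (discrete.K (\<iota> v) - exact.K (\<iota> v)) v"
proof -
  have "(norm (v - p))\<^sup>2 = \<iota> (v - p) \<bullet> \<iota> (v - p)"
    using norm_sq[of "v - p"] p(2) by (simp add: form_kernel_iff power2_norm_eq_inner)
  also have "\<dots> = \<iota> (v - p) \<bullet> \<iota> v"
    using incl_orthogonal[OF p] by (simp add: incl.diff[of v p] inner_diff_right)
  also have "\<dots> = \<iota> v \<bullet> \<iota> v - \<iota> v \<bullet> \<iota> p"
    unfolding incl.diff inner_diff_left by (simp add: inner_commute)
  also have "\<dots> = a (discrete.K (\<iota> v)) v - a (exact.K (\<iota> v)) p"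
    by (simp add: discrete.solution_eq[OF v] exact.solution_eq[OF p(1)])
  also have "a (exact.K (\<iota> v)) p = a (exact.K (\<iota> v)) v"
    using form_kernel_part[OF p(2)] by simp
  finally show ?thesis by (simp add: form.diff_left)
qed

lemma gap_le_sqrt_error:
  assumes eps: "0 \<le> \<epsilon>" and error: "\<And>u. norm (exact.K u - discrete.K u) \<le> \<epsilon> * norm u"
  shows "gap discrete.V exact.V \<le> sqrt \<epsilon>"
proof (rule gap_le)
  fix v assume v: "v \<in> discrete.V"
  obtain p where p: "p \<in> exact.V" "v - p \<in> exact.W" using exact.decomposition[of v] by auto
  have "(norm (v - p))\<^sup>2 \<le> norm (discrete.K (\<iota> v) - exact.K (\<iota> v)) * norm v"
    using defect_sq[OF v p] form_le[of "discrete.K (\<iota> v) - exact.K (\<iota> v)" v] by linarith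
  also have "\<dots> \<le> (\<epsilon> * norm v) * norm v"
  proof (rule mult_right_mono)
    have "norm (discrete.K (\<iota> v) - exact.K (\<iota> v)) \<le> \<epsilon> * norm (\<iota> v)"
      using error[of "\<iota> v"] by (simp add: norm_minus_commute)
    also have "\<dots> \<le> \<epsilon> * norm v" using eps norm_incl_le by (rule mult_left_mono[rotated])
    finally show "norm (discrete.K (\<iota> v) - exact.K (\<iota> v)) \<le> \<epsilon> * norm v" .
  qed simp
  also have "\<dots> = (sqrt \<epsilon> * norm v)\<^sup>2"
    using eps by (simp add: power_mult_distrib power2_eq_square mult.assoc)
  finally have "norm (v - p) \<le> sqrt \<epsilon> * norm v"
    by (rule power2_le_imp_le) (use eps in simp)
  thus "infdist v exact.V \<le> sqrt \<epsilon> * norm v" by (simp add: infdist_exact[OF p])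
qed (use eps in simp)

text \<open>Data in W are annihilated by \<open>K\<close>, so on \<open>\<iota> w\<close> the
  discrete solution is itself the error up to sign. Symmetry of the discrete operator moves it from
  \<open>u\<close> to \<open>w\<close>.\<close>

lemma solution_kernel_part:
  assumes error: "norm (\<iota> (exact.K (\<iota> w) - discrete.K (\<iota> w))) \<le> \<epsilon> * norm (\<iota> w)"
    and "0 \<le> \<epsilon>"
    and p: "p \<in> exact.V" "w \<in> exact.W" "w = discrete.K u - p"
  shows "norm (\<iota> w) \<le> \<epsilon> * norm u"
proof (cases "\<iota> w = 0")
  case True
  thus ?thesis using \<open>0 \<le> \<epsilon>\<close> by simp
next
  case False
  have Kw: "exact.K (\<iota> w) = 0"
    using exact.subspace_V incl_orthogonal[OF _ p(2)]
    by (intro exact.solution_unique) (auto simp: subspace_0 form.zero_left)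
  have "(norm (\<iota> w))\<^sup>2 = \<iota> w \<bullet> \<iota> (discrete.K u)"
    using incl_orthogonal[OF p(1,2)] unfolding power2_norm_eq_inner
    by (subst (2) p(3)) (simp add: incl.diff inner_diff_right)
  also have "\<dots> = u \<bullet> \<iota> (discrete.K (\<iota> w))"
    using discrete.solution_eq[OF discrete.solution_in] form_sym by metis
  also have "\<dots> \<le> norm u * norm (\<iota> (discrete.K (\<iota> w)))" by (rule norm_cauchy_schwarz)
  also have "\<dots> \<le> norm u * (\<epsilon> * norm (\<iota> w))"
    using error by (intro mult_left_mono) (auto simp: Kw incl.neg)
  finally show ?thesis using False by (simp add: power2_eq_square mult.commute)
qed

lemma error_le_incl_error:
  assumes eps: "0 \<le> \<epsilon>" and error: "\<And>u. norm (\<iota> (exact.K u - discrete.K u)) \<le> \<epsilon> * norm u"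
  shows "norm (exact.K u - discrete.K u) \<le> sqrt (\<epsilon>\<^sup>2 + 3 * \<epsilon>) * norm u"
proof -
  define v where "v = discrete.K u"
  obtain p where p: "p \<in> exact.V" "v - p \<in> exact.W" using exact.decomposition[of v] by auto
  define w e where "w = v - p" and "e = exact.K u - v"
  have w: "norm (\<iota> w) \<le> \<epsilon> * norm u"
    using solution_kernel_part[of w \<epsilon> p u] p error by (simp add: w_def v_def eps)
  have e: "norm (\<iota> e) \<le> \<epsilon> * norm u" using error[of u] by (simp add: e_def v_def)
  have "a (exact.K u) (exact.K u) = u \<bullet> \<iota> (exact.K u)"
    by (rule exact.solution_eq[OF exact.solution_in])
  moreover have "a (exact.K u) v = u \<bullet> \<iota> p"
    using form_kernel_part[OF p(2)] exact.solution_eq[OF p(1)] by simp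
  moreover have "a v v = u \<bullet> \<iota> v"
    unfolding v_def by (rule discrete.solution_eq[OF discrete.solution_in])
  \<comment> \<open>The exact equation only produces \<open>\<iota> p\<close>; replacing it by
    \<open>\<iota> v - \<iota> w\<close> leaves the error in O and twice the kernel part.\<close>
  ultimately have "a e e = u \<bullet> \<iota> e + 2 * (u \<bullet> \<iota> w)"
    by (simp add: e_def w_def form_diff_sq incl.diff inner_diff_right)
  also have "\<dots> \<le> norm u * (\<epsilon> * norm u) + 2 * (norm u * (\<epsilon> * norm u))"
    using norm_cauchy_schwarz[of u "\<iota> e"] norm_cauchy_schwarz[of u "\<iota> w"]
      mult_left_mono[OF e, of "norm u"] mult_left_mono[OF w, of "norm u"]
    by (smt (verit) norm_ge_zero)
  finally have "(norm e)\<^sup>2 \<le> (\<epsilon> * norm u)\<^sup>2 + 3 * (norm u * (\<epsilon> * norm u))"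
    using norm_sq[of e] power_mono[OF e norm_ge_zero, of 2] by linarith
  also have "\<dots> = (\<epsilon>\<^sup>2 + 3 * \<epsilon>) * (norm u)\<^sup>2"
    by (simp add: algebra_simps power2_eq_square)
  also have "\<dots> = (sqrt (\<epsilon>\<^sup>2 + 3 * \<epsilon>) * norm u)\<^sup>2"
    using eps by (simp add: power_mult_distrib)
  finally show ?thesis
    unfolding e_def v_def by (rule power2_le_imp_le) (use eps in simp)
qed

text \<open>At least half of the norm of \<open>v\<close> sits in its V-part, which has the same
  energy; squaring the factor 2 gives 4.\<close>

lemma discrete_poincare:
  assumes C: "\<And>v. v \<in> exact.V \<Longrightarrow> (norm v)\<^sup>2 \<le> C * a v v"
    and gap: "infdist v exact.V \<le> norm v / 2"
  shows "(norm v)\<^sup>2 \<le> 4 * C * a v v"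
proof -
  obtain p where p: "p \<in> exact.V" "v - p \<in> exact.W" using exact.decomposition[of v] by auto
  have "norm v \<le> norm p + norm (v - p)" using norm_triangle_ineq[of p "v - p"] by simp
  hence "norm v \<le> 2 * norm p" using gap by (simp add: infdist_exact[OF p])
  hence "(norm v)\<^sup>2 \<le> 4 * (norm p)\<^sup>2" using power_mono[of "norm v" "2 * norm p" 2] by simp
  moreover have "a p p = a v v"
    using form_kernel_part[OF p(2)] form_sym by metis
  ultimately show ?thesis using C[OF p(1)] by simp
qed

text \<open>An estimate of Strang type: best approximation of \<open>K u\<close> in \<open>S\<close>
  plus the consistency error caused by V_n not lying in V. The factor 5 is 4 from the discrete
  Poincare inequality plus 1 for the approximation error, absorbed by
  \<open>C \<ge> 1\<close>.\<close>

lemma error_le_gap: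
  assumes C: "C \<ge> 1" "\<And>v. v \<in> exact.V \<Longrightarrow> (norm v)\<^sup>2 \<le> C * a v v"
    and \<delta>: "0 \<le> \<delta>" "\<delta> \<le> 1 / 2" "\<And>v. v \<in> discrete.V \<Longrightarrow> infdist v exact.V \<le> \<delta> * norm v"
  shows "norm (exact.K u - discrete.K u) \<le> 5 * C * (infdist (exact.K u) S + \<delta> * norm u)"
proof -
  define k \<eta> where "k = exact.K u" and "\<eta> = infdist (exact.K u) S"
  obtain x where x: "x \<in> S" "\<And>y. y \<in> S \<Longrightarrow> (k - x) \<bullet> y = 0"
    using orthogonal_projection[OF discrete.subspace_S discrete.closed_S, of k] by metis
  have \<eta>: "norm (k - x) = \<eta>"
    using infdist_orthogonal[OF discrete.subspace_S x] by (simp add: \<eta>_def k_def)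
  \<comment> \<open>Discrete kernel vectors lie in W, where orthogonality in X and in O coincide, so
    the projection \<open>x\<close> inherits from \<open>k\<close> the orthogonality to
    them.\<close>
  have "\<iota> x \<bullet> \<iota> w = 0" if w: "w \<in> discrete.W" for w
  proof -
    have wS: "w \<in> S" "w \<in> exact.W" using w by (auto simp: form_kernel_iff)
    have "a y w = 0" for y using wS(2) form_eq_0[of w y] form_sym[of y w] by (simp add: form_kernel_iff)
    moreover have "\<iota> w \<bullet> \<iota> k = 0"
      unfolding k_def by (rule incl_orthogonal[OF exact.solution_in wS(2)])
    ultimately show ?thesis
      using x(2)[OF wS(1)] inner_eq[of x w] inner_eq[of k w]
      by (simp add: inner_diff_left inner_commute[of "\<iota> w"])
  qed
  hence xV: "x \<in> discrete.V" using x(1) by (simp add: form_complement_def)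
  define e where "e = x - discrete.K u"
  have eV: "e \<in> discrete.V"
    unfolding e_def using discrete.subspace_V xV discrete.solution_in by (rule subspace_diff)
  obtain q where q: "q \<in> exact.V" "e - q \<in> exact.W" using exact.decomposition[of e] by auto
  have r: "norm (e - q) \<le> \<delta> * norm e" using \<delta>(3)[OF eV] by (simp add: infdist_exact[OF q])
  have "a e e = a (x - k) e + (a k e - a (discrete.K u) e)"
    by (simp add: e_def form.diff_left)
  also have "a k e = u \<bullet> \<iota> q"
    unfolding k_def using form_kernel_part[OF q(2)] exact.solution_eq[OF q(1)] by simp
  also have "a (discrete.K u) e = u \<bullet> \<iota> e" by (rule discrete.solution_eq[OF eV])
  also have "a (x - k) e \<le> \<eta> * norm e"
    using form_le[of "x - k" e] \<eta> by (simp add: norm_minus_commute)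
  \<comment> \<open>The consistency error: \<open>K\<close> is tested with \<open>q\<close>, the
    discrete operator with \<open>e\<close>, and they differ by a W-part that the gap
    controls.\<close>
  also have "u \<bullet> \<iota> q - u \<bullet> \<iota> e = u \<bullet> \<iota> (q - e)" by (simp add: incl.diff inner_diff_right)
  also have "\<dots> \<le> norm u * norm (\<iota> (q - e))" by (rule norm_cauchy_schwarz)
  also have "\<dots> \<le> norm u * (\<delta> * norm e)"
    using norm_incl_le[of "q - e"] r by (intro mult_left_mono) (auto simp: norm_minus_commute)
  finally have aee: "a e e \<le> (\<eta> + \<delta> * norm u) * norm e" by (simp add: algebra_simps)
  have "infdist e exact.V \<le> norm e / 2"
    using \<delta>(3)[OF eV] mult_right_mono[OF \<delta>(2) norm_ge_zero[of e]] by simp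
  hence "(norm e)\<^sup>2 \<le> 4 * C * a e e" using discrete_poincare C(2) by blast
  also have "\<dots> \<le> 4 * C * ((\<eta> + \<delta> * norm u) * norm e)"
    using aee C(1) by (intro mult_left_mono) auto
  finally have *: "norm e * norm e \<le> (4 * C * (\<eta> + \<delta> * norm u)) * norm e"
    by (simp add: power2_eq_square mult.assoc)
  define h where "h = \<eta> + \<delta> * norm u"
  have h: "0 \<le> h" using \<delta>(1) by (simp add: h_def \<eta>_def infdist_nonneg)
  have "norm e \<le> 4 * C * h"
    using * h C(1) unfolding h_def[symmetric] by (cases "norm e = 0") auto
  moreover have "\<eta> \<le> C * h"
  proof -
    have "\<eta> \<le> 1 * h" using \<delta>(1) by (simp add: h_def)
    also have "\<dots> \<le> C * h" using C(1) h by (rule mult_right_mono)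
    finally show ?thesis .
  qed
  moreover have "norm (k - discrete.K u) \<le> norm (k - x) + norm e"
    using norm_triangle_ineq[of "k - x" e] by (simp add: e_def)
  ultimately have "norm (k - discrete.K u) \<le> 5 * C * h" using \<eta> by linarith
  thus ?thesis by (simp add: k_def h_def \<eta>_def)
qed

end

section \<open>Equivalence of gap convergence and the two operator convergences\<close>

theorem proposition14:
  fixes \<iota> :: "'x::{real_inner, complete_space} \<Rightarrow> 'o::{real_inner, complete_space}"
    and a :: "'x \<Rightarrow> 'x \<Rightarrow> real"
    and Xn :: "nat \<Rightarrow> 'x set"
  assumes O_infinite_dim: "\<not> (\<exists>B :: 'o set. finite B \<and> span B = UNIV)"
    and O_separable: "\<exists>D :: 'o set. countable D \<and> closure D = UNIV"
    and incl_continuous: "bounded_linear \<iota>"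
    and incl_inj: "inj \<iota>"
    and X_dense: "closure (range \<iota>) = UNIV"
    and a_continuous: "bounded_bilinear a"
    and a_sym: "\<And>u v. a u v = a v u"
    and a_nonneg: "\<And>u. a u u \<ge> 0"
    and X_inner: "\<And>u v. u \<bullet> v = \<iota> u \<bullet> \<iota> v + a u v"
    and V_compact: "compact_map_on (form_complement \<iota> a UNIV) \<iota>"
    and Xn_subspace: "\<And>n. subspace (Xn n)"
    and Xn_finite_dim: "\<And>n. \<exists>B. finite B \<and> span B = Xn n"
    and AS: "\<And>u. (\<lambda>n. infdist u (Xn n)) \<longlonglongrightarrow> 0"
  defines "V \<equiv> form_complement \<iota> a UNIV"
    and "Vn \<equiv> \<lambda>n. form_complement \<iota> a (Xn n)"
    and "K \<equiv> solution_operator \<iota> a UNIV"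
    and "Kn \<equiv> \<lambda>n. solution_operator \<iota> a (Xn n)"
  shows "((\<lambda>n. gap (Vn n) V) \<longlonglongrightarrow> 0
            \<longleftrightarrow> (\<lambda>n. onorm (\<lambda>u. K u - Kn n u)) \<longlonglongrightarrow> 0)
       \<and> ((\<lambda>n. onorm (\<lambda>u. K u - Kn n u)) \<longlonglongrightarrow> 0
            \<longleftrightarrow> (\<lambda>n. onorm (\<lambda>u. \<iota> (K u - Kn n u))) \<longlonglongrightarrow> 0)"
proof -
  interpret form: semidefinite_form \<iota> a
    by (intro semidefinite_form.intro incl_continuous a_continuous a_sym a_nonneg X_inner)
  interpret exact: form_space \<iota> a UNIV
    using V_compact by unfold_locales auto
  have discrete: "form_space \<iota> a (Xn n)" for n
  proof -
    obtain B where B: "finite B" "span B = Xn n" using Xn_finite_dim by blast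
    have "compact_map_on (form_complement \<iota> a (Xn n)) \<iota>"
      by (rule compact_map_on_finite_span[OF B(1) _ incl_continuous])
        (auto simp: B(2) form_complement_def)
    moreover have "closed (Xn n)" using closed_span_finite[OF B(1)] B(2) by simp
    ultimately show ?thesis using Xn_subspace[of n] by unfold_locales
  qed
  have galerkin: "galerkin \<iota> a (Xn n)" for n
    by (intro galerkin.intro form.semidefinite_form_axioms exact.form_space_axioms discrete)
  define E where "E n u = K u - Kn n u" for n u
  have E: "bounded_linear (E n)" for n
    unfolding E_def K_def Kn_def
    by (intro bounded_linear_sub exact.bounded_linear_solution
        form_space.bounded_linear_solution discrete)
  have iE: "bounded_linear (\<lambda>u. \<iota> (E n u))" for n
    by (rule bounded_linear_compose[OF incl_continuous E])
  have V0: "0 \<in> V" unfolding V_def by (rule subspace_0[OF exact.subspace_V])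
  have gap_iff: "(\<lambda>n. gap (Vn n) V) \<longlonglongrightarrow> 0 \<longleftrightarrow>
      (\<forall>e>0. \<forall>\<^sub>F n in sequentially. gap (Vn n) V \<le> e)"
    by (intro tendsto_zero_iff_eventually_le gap_nonneg V0)
  have E_iff: "(\<lambda>n. onorm (E n)) \<longlonglongrightarrow> 0 \<longleftrightarrow>
      (\<forall>e>0. \<forall>\<^sub>F n in sequentially. onorm (E n) \<le> e)"
    by (intro tendsto_zero_iff_eventually_le onorm_pos_le E)
  have iE_iff: "(\<lambda>n. onorm (\<lambda>u. \<iota> (E n u))) \<longlonglongrightarrow> 0 \<longleftrightarrow>
      (\<forall>e>0. \<forall>\<^sub>F n in sequentially. onorm (\<lambda>u. \<iota> (E n u)) \<le> e)"
    by (intro tendsto_zero_iff_eventually_le onorm_pos_le iE)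
  have E_le: "norm (E n u) \<le> d * norm u" if "onorm (E n) \<le> d" for n u d
    using onorm[OF E, of n u] mult_right_mono[OF that norm_ge_zero[of u]] by linarith
  have iE_le: "norm (\<iota> (E n u)) \<le> d * norm u" if "onorm (\<lambda>u. \<iota> (E n u)) \<le> d" for n u d
    using onorm[OF iE, of n u] mult_right_mono[OF that norm_ge_zero[of u]] by linarith
  have VG_imp: "\<forall>\<^sub>F n in sequentially. onorm (E n) \<le> e"
    if VG: "\<forall>e>0. \<forall>\<^sub>F n in sequentially. gap (Vn n) V \<le> e" and e: "e > 0" for e
  proof -
    obtain C where C: "C \<ge> 1" "\<And>v. v \<in> V \<Longrightarrow> (norm v)\<^sup>2 \<le> C * a v v"
      unfolding V_def using exact.poincare by blast
    \<comment> \<open>The bound \<open>1 / 2\<close> gives the discrete Poincare inequality; the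
      other one makes \<open>5 * C * (d + d)\<close> at most \<open>e\<close>.\<close>
    define d where "d = min (1 / 2) (e / (10 * C))"
    have d: "d > 0" "d \<le> 1 / 2" "10 * C * d \<le> e"
      using e C(1) by (auto simp: d_def min_def field_simps)
    have "\<forall>\<^sub>F n in sequentially. \<forall>u. infdist (K u) (Xn n) \<le> d * norm u"
      unfolding K_def by (rule exact.uniform_approximation[OF Xn_subspace AS d(1)])
    moreover have "\<forall>\<^sub>F n in sequentially. gap (Vn n) V \<le> d" using VG d(1) by blast
    ultimately show ?thesis
    proof eventually_elim
      case (elim n)
      interpret galerkin \<iota> a "Xn n" by (rule galerkin)
      have gap_d: "infdist v V \<le> d * norm v" if "v \<in> Vn n" for v
        using infdist_le_gap[OF V0 that] mult_right_mono[OF elim(2) norm_ge_zero[of v]] by linarith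
      show ?case
      proof (rule onorm_bound)
        fix u
        have "norm (E n u) \<le> 5 * C * (infdist (K u) (Xn n) + d * norm u)"
          using error_le_gap[of C d u] C less_imp_le[OF d(1)] d(2) gap_d
          unfolding E_def K_def Kn_def V_def Vn_def by blast
        also have "\<dots> \<le> 5 * C * (d * norm u + d * norm u)"
          using elim(1) C(1) by (intro mult_left_mono add_right_mono) auto
        also have "\<dots> = (10 * C * d) * norm u" by simp
        also have "\<dots> \<le> e * norm u" using d(3) by (rule mult_right_mono) simp
        finally show "norm (E n u) \<le> e * norm u" .
      qed (use e in simp)
    qed
  qed
  have imp_VG: "\<forall>\<^sub>F n in sequentially. gap (Vn n) V \<le> e"
    if conv: "\<forall>e>0. \<forall>\<^sub>F n in sequentially. onorm (E n) \<le> e" and e: "e > 0" for e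
  proof -
    \<comment> \<open>Squared because the gap is bounded by the square root of the error.\<close>
    have "\<forall>\<^sub>F n in sequentially. onorm (E n) \<le> e\<^sup>2" using conv e by simp
    thus ?thesis
    proof eventually_elim
      case (elim n)
      interpret galerkin \<iota> a "Xn n" by (rule galerkin)
      have "gap (Vn n) V \<le> sqrt (e\<^sup>2)"
        unfolding Vn_def V_def
        by (rule gap_le_sqrt_error) (use E_le[OF elim] in \<open>simp_all add: E_def K_def Kn_def\<close>)
      thus ?case using e by simp
    qed
  qed
  have imp_NC: "onorm (\<lambda>u. \<iota> (E n u)) \<le> onorm (E n)" for n
  proof (rule onorm_bound)
    show "norm (\<iota> (E n u)) \<le> onorm (E n) * norm u" for u
      using form.norm_incl_le[of "E n u"] onorm[OF E, of n u] by linarith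
  qed (rule onorm_pos_le[OF E])
  have NC_imp: "\<forall>\<^sub>F n in sequentially. onorm (E n) \<le> e"
    if NC: "\<forall>e>0. \<forall>\<^sub>F n in sequentially. onorm (\<lambda>u. \<iota> (E n u)) \<le> e" and e: "e > 0" for e
  proof -
    \<comment> \<open>Chosen so that
      \<open>d\<^sup>2 + 3 * d \<le> 4 * d \<le> e\<^sup>2\<close>.\<close>
    define d where "d = min 1 (e\<^sup>2 / 4)"
    have d: "0 < d" "d \<le> 1" "4 * d \<le> e\<^sup>2" using e by (auto simp: d_def)
    have "d\<^sup>2 \<le> d" using d mult_left_mono[of d 1 d] by (simp add: power2_eq_square)
    hence "sqrt (d\<^sup>2 + 3 * d) \<le> sqrt (e\<^sup>2)" using d by (intro real_sqrt_le_mono) linarith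
    hence sqrt_le: "sqrt (d\<^sup>2 + 3 * d) \<le> e" using e by simp
    have "\<forall>\<^sub>F n in sequentially. onorm (\<lambda>u. \<iota> (E n u)) \<le> d" using NC d(1) by blast
    thus ?thesis
    proof eventually_elim
      case (elim n)
      interpret galerkin \<iota> a "Xn n" by (rule galerkin)
      show ?case
      proof (rule onorm_bound)
        fix u
        have "norm (E n u) \<le> sqrt (d\<^sup>2 + 3 * d) * norm u"
          unfolding E_def K_def Kn_def
          by (rule error_le_incl_error)
            (use d(1) iE_le[OF elim] in \<open>simp_all add: E_def K_def Kn_def\<close>)
        also have "\<dots> \<le> e * norm u" using sqrt_le by (rule mult_right_mono) simp
        finally show "norm (E n u) \<le> e * norm u" .
      qed (use e in simp)
    qed
  qed
  have "(\<lambda>n. gap (Vn n) V) \<longlonglongrightarrow> 0 \<longleftrightarrow> (\<lambda>n. onorm (E n)) \<longlonglongrightarrow> 0"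
    unfolding gap_iff E_iff using VG_imp imp_VG by blast
  moreover have "(\<lambda>n. onorm (E n)) \<longlonglongrightarrow> 0 \<longleftrightarrow> (\<lambda>n. onorm (\<lambda>u. \<iota> (E n u))) \<longlonglongrightarrow> 0"
    unfolding E_iff iE_iff
    using NC_imp imp_NC by (blast intro: eventually_mono order_trans)
  ultimately show ?thesis unfolding E_def by blast
qed

end
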